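(* Let $p_1,\ldots,p_n$ be relatively prime positive integers, let $p=(p_1,\ldots,p_n)$, and let $G$ be a Gröbner basis of the lattice ideal $I_{\mathcal L}$ with respect to the term order $\leq$ defined in the context. Then the following algorithm determines whether $t\in\mathbb{N}$ is $p$-representable. Step 1: Compute an $a\in\mathbb{Z}^n$ such that $a\cdot p=t$, $a_1\le 0$ and $a_i\ge 0$ for $i=2,\ldots,n$. Step 2: Divide $x^{a^+}-x^{a^-}$ by $G$, giving remainder $x^w(x^{c^+}-x^{c^-})$ for some $w\in\mathbb{N}^n$ (and $c\in\mathbb{Z}^n$), where $x^{c^-}\leq x^{c^+}$. Step 3: Then $t$ is $p$-representable if and only if $c\in\mathbb{N}^n$.
   Context: $\mathbb{N}$ includes $0$. "Relatively prime" means $\gcd(p_1,\ldots,p_n)=1$ (not necessarily pairwise coprime). An integer $t$ is $p$-representable if $t=v\cdot p$ for some $v\in\mathbb{N}^n$. The $p$-degree of $v\in\mathbb{Z}^n$ is $v\cdot p$. For $v\in\mathbb{Z}^n$, $v^+\in\mathbb{N}^n$ is given by $v^+_i=\max(v_i,0)$ and $v^-:=(-v)^+$. For $v\in\mathbb{N}^n$, $x^v=x_1^{v_1}\cdots x_n^{v_n}$ in the polynomial ring $k[x_1,\ldots,x_n]$ over a field $k$. The lattice ideal is $I_{\mathcal L}=\langle x^{v^+}-x^{v^-} \mid v\in\mathbb{Z}^n,\ v\cdot p=0\rangle$. The term order $\leq$ first compares the $p$-degree of exponent vectors, and breaks ties by the reverse lexicographic order with $x_1<x_2<\cdots<x_n$: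 if $u\ne v$ have equal $p$-degree, then $x^u<x^v$ iff $u_i>v_i$ for the smallest index $i$ with $u_i\neq v_i$. Division by $G$ is polynomial division with respect to $\leq$.
   Formalization: The existence of the vector a in Step 1 is claimed only for n ≥ 2; for n = 1 relative primality forces p = (1), and then a_1 = t > 0 contradicts a_1 ≤ 0, so Step 1 cannot be carried out. *)

theory Defs
  imports Complex_Main "HOL-Library.Poly_Mapping"
begin

text \<open>
  The index set \<open>{1,...,n}\<close> is a finite linearly ordered type \<open>'n\<close>, so \<open>n = card (UNIV :: 'n set) \<ge> 1\<close> and the
  index \<open>1\<close> is \<open>Min UNIV\<close>. Since \<open>'n\<close> is finite, \<open>'n \<Rightarrow>\<^sub>0 int\<close> and \<open>'n \<Rightarrow>\<^sub>0 nat\<close> are all of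
  $\mathbb{Z}^n$ and $\mathbb{N}^n$; the polynomial ring over \<open>'k\<close> consists of the finitely
  supported maps from exponent vectors to coefficients, with the convolution product.
\<close>

type_synonym ('n, 'k) mpoly = "('n \<Rightarrow>\<^sub>0 nat) \<Rightarrow>\<^sub>0 'k"

definition pdeg :: "('n::finite \<Rightarrow> nat) \<Rightarrow> ('n \<Rightarrow>\<^sub>0 'a::semiring_1) \<Rightarrow> 'a" where
  "pdeg p v = (\<Sum>i\<in>UNIV. Poly_Mapping.lookup v i * of_nat (p i))"

definition representable :: "('n::finite \<Rightarrow> nat) \<Rightarrow> int \<Rightarrow> bool" where
  "representable p t \<longleftrightarrow> (\<exists>v :: 'n \<Rightarrow>\<^sub>0 nat. t = int (pdeg p v))"

definition pos_part :: "('n \<Rightarrow>\<^sub>0 int) \<Rightarrow> ('n \<Rightarrow>\<^sub>0 nat)" where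
  "pos_part v = Poly_Mapping.map nat v"

definition neg_part :: "('n \<Rightarrow>\<^sub>0 int) \<Rightarrow> ('n \<Rightarrow>\<^sub>0 nat)" where
  "neg_part v = pos_part (- v)"

lemma lookup_pos_part: "int (Poly_Mapping.lookup (pos_part v) i) = max (Poly_Mapping.lookup v i) 0"
  by (simp add: pos_part_def Poly_Mapping.map.rep_eq when_def)

definition xpow :: "('n \<Rightarrow>\<^sub>0 nat) \<Rightarrow> ('n, 'k::field) mpoly" where
  "xpow v = Poly_Mapping.single v 1"

definition binomial_of :: "('n \<Rightarrow>\<^sub>0 int) \<Rightarrow> ('n, 'k::field) mpoly" where
  "binomial_of v = xpow (pos_part v) - xpow (neg_part v)"

definition ideal_gen :: "'a::comm_ring_1 set \<Rightarrow> 'a set" where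
  "ideal_gen S = module.span (*) S"

definition lattice_ideal :: "('n::finite \<Rightarrow> nat) \<Rightarrow> ('n, 'k::field) mpoly set" where
  "lattice_ideal p = ideal_gen {binomial_of v | v. pdeg p v = 0}"

definition term_less :: "('n::{finite,linorder} \<Rightarrow> nat) \<Rightarrow> ('n \<Rightarrow>\<^sub>0 nat) \<Rightarrow> ('n \<Rightarrow>\<^sub>0 nat) \<Rightarrow> bool" where
  "term_less p u v \<longleftrightarrow> pdeg p u < pdeg p v \<or>
     (pdeg p u = pdeg p v \<and>
      (\<exists>i. Poly_Mapping.lookup u i > Poly_Mapping.lookup v i \<and> (\<forall>j<i. Poly_Mapping.lookup u j = Poly_Mapping.lookup v j)))"

definition term_le :: "('n::{finite,linorder} \<Rightarrow> nat) \<Rightarrow> ('n \<Rightarrow>\<^sub>0 nat) \<Rightarrow> ('n \<Rightarrow>\<^sub>0 nat) \<Rightarrow> bool" where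
  "term_le p u v \<longleftrightarrow> term_less p u v \<or> u = v"

text \<open>\<open>is_lead p f u\<close>: \<open>u\<close> is the exponent vector of the leading term of \<open>f\<close>. The zero polynomial
  has none.\<close>

definition is_lead ::
    "('n::{finite,linorder} \<Rightarrow> nat) \<Rightarrow> ('n, 'k::field) mpoly \<Rightarrow> ('n \<Rightarrow>\<^sub>0 nat) \<Rightarrow> bool" where
  "is_lead p f u \<longleftrightarrow> u \<in> Poly_Mapping.keys f \<and> (\<forall>v\<in>Poly_Mapping.keys f. term_le p v u)"

definition initial_ideal ::
    "('n::{finite,linorder} \<Rightarrow> nat) \<Rightarrow> ('n, 'k::field) mpoly set \<Rightarrow> ('n, 'k) mpoly set" where
  "initial_ideal p F = ideal_gen {xpow u | u. \<exists>f\<in>F. is_lead p f u}"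

definition groebner_basis ::
    "('n::{finite,linorder} \<Rightarrow> nat) \<Rightarrow> ('n, 'k::field) mpoly set \<Rightarrow> ('n, 'k) mpoly set \<Rightarrow> bool" where
  "groebner_basis p G I \<longleftrightarrow>
     finite G \<and> G \<subseteq> I \<and> initial_ideal p G = initial_ideal p I"

text \<open>
  \<open>is_remainder p G f r\<close>: \<open>r\<close> is a remainder on division of \<open>f\<close> by the (finite) set \<open>G\<close>, i.e. there
  is a standard expression of \<open>f\<close>: the summands \<open>q g * g\<close> that do not vanish have leading monomial at
  most that of \<open>f\<close>, and no monomial of \<open>r\<close> is divisible by the leading monomial of an element of
  \<open>G\<close>. For \<open>f = 0\<close> this forces \<open>r = 0\<close>.
\<close>

definition is_remainder ::
    "('n::{finite,linorder} \<Rightarrow> nat) \<Rightarrow> ('n, 'k::field) mpoly set \<Rightarrow>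
     ('n, 'k) mpoly \<Rightarrow> ('n, 'k) mpoly \<Rightarrow> bool" where
  "is_remainder p G f r \<longleftrightarrow>
     (\<exists>q. f = (\<Sum>g\<in>G. q g * g) + r \<and>
          (\<forall>g\<in>G. \<forall>u. is_lead p (q g * g) u \<longrightarrow> (\<exists>v. is_lead p f v \<and> term_le p u v))) \<and>
     (\<forall>u\<in>Poly_Mapping.keys r. \<forall>g\<in>G. \<forall>v. is_lead p g v \<longrightarrow>
        \<not> (xpow v :: ('n, 'k) mpoly) dvd xpow u)"

definition step1 :: "('n::{finite,linorder} \<Rightarrow> nat) \<Rightarrow> nat \<Rightarrow> ('n \<Rightarrow>\<^sub>0 int) \<Rightarrow> bool" where
  "step1 p t a \<longleftrightarrow> pdeg p a = int t \<and>
     Poly_Mapping.lookup a (Min UNIV) \<le> 0 \<and> (\<forall>i. i \<noteq> Min UNIV \<longrightarrow> Poly_Mapping.lookup a i \<ge> 0)"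

end

theory Submission
  imports Defs
begin

text \<open>
  Any two monomials of the same degree are congruent modulo the lattice ideal, so every monomial
  that is not the least one of its degree is divisible by the leading monomial of an element of
  \<open>G\<close>. A remainder therefore involves only least monomials, and since substituting \<open>z ^ p i\<close> for the
  variables kills the lattice ideal but separates monomials of different degree, the remainder of
  $x^{a^+}-x^{a^-}$ is $x^m-x^{m'}$ with $m$, $m'$ the least monomials of the degrees of $a^+$, $a^-$.
  As $a^-$ is a multiple of $e_1$, it is itself least, so $m'=a^-=s e_1$ and $c=m-s e_1$. If
  $t=z\cdot p$, then $z+s e_1$ competes with $m$ in its degree, and minimality of $m$ forces
  $m_1\ge s+z_1\ge s$, that is $c\ge 0$.
\<close>

abbreviation lkp where "lkp \<equiv> Poly_Mapping.lookup"

subsection \<open>The degree and the term order\<close>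

lemma pdeg_add: "pdeg p (u + v) = pdeg p u + pdeg p v"
  by (simp add: pdeg_def lookup_add algebra_simps sum.distrib)

lemma pdeg_strict_mono:
  fixes u v :: "'n::finite \<Rightarrow>\<^sub>0 nat"
  assumes "\<And>i. lkp u i \<le> lkp v i" and "lkp u j < lkp v j" and "p j > 0"
  shows "pdeg p u < pdeg p v"
  unfolding pdeg_def
  by (rule sum_strict_mono_ex1) (use assms in \<open>auto intro!: mult_right_mono bexI[of _ j]\<close>)

text \<open>Weights of at least 1 confine every coordinate of such a \<open>u\<close> to the range
  from 0 to \<open>d\<close>.\<close>

lemma finite_pdeg_le:
  fixes p :: "'n::finite \<Rightarrow> nat"
  assumes "\<And>i. p i > 0"
  shows "finite {u :: 'n \<Rightarrow>\<^sub>0 nat. pdeg p u \<le> d}"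
proof -
  have bd: "lkp u i \<le> d" if "pdeg p u \<le> d" for u :: "'n \<Rightarrow>\<^sub>0 nat" and i
  proof -
    have "lkp u i \<le> lkp u i * of_nat (p i)" using assms[of i] by simp
    also have "\<dots> \<le> pdeg p u" unfolding pdeg_def by (rule member_le_sum) auto
    finally show ?thesis using that by simp
  qed
  have "finite {h :: 'n \<Rightarrow> nat. \<forall>i. (i \<in> UNIV \<longrightarrow> h i \<in> {..d}) \<and> (i \<notin> UNIV \<longrightarrow> h i = 0)}"
    by (rule finite_set_of_finite_funs) simp_all
  hence "finite (lkp ` {u :: 'n \<Rightarrow>\<^sub>0 nat. pdeg p u \<le> d})"
    by (rule rev_finite_subset) (use bd in auto)
  thus ?thesis by (rule finite_imageD) (simp add: inj_on_def poly_mapping.lookup_inject)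
qed

lemma term_less_irrefl: "\<not> term_less p u u"
  by (auto simp: term_less_def)

lemma term_less_trans:
  assumes "term_less p u v" and "term_less p v w"
  shows "term_less p u w"
proof (cases "pdeg p u = pdeg p v \<and> pdeg p v = pdeg p w")
  case True
  then obtain i j where i: "lkp u i > lkp v i" "\<forall>k<i. lkp u k = lkp v k"
    and j: "lkp v j > lkp w j" "\<forall>k<j. lkp v k = lkp w k"
    using assms by (auto simp: term_less_def)
  \<comment> \<open>The smaller of the two deciding indices decides between \<open>u\<close> and
    \<open>w\<close>.\<close>
  have "lkp u (min i j) > lkp w (min i j)"
    using i j by (cases i j rule: linorder_cases) (auto simp: min_def)
  moreover have "\<forall>k<min i j. lkp u k = lkp w k" using i j by auto
  ultimately show ?thesis using True unfolding term_less_def by auto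
next
  case False
  thus ?thesis using assms by (auto simp: term_less_def)
qed

lemma term_less_linear: "term_less p u v \<or> u = v \<or> term_less p v u"
proof (cases "pdeg p u = pdeg p v \<and> u \<noteq> v")
  case True
  define i where "i = Min {i. lkp u i \<noteq> lkp v i}"
  have ne: "{i. lkp u i \<noteq> lkp v i} \<noteq> {}"
    using True poly_mapping_eqI[of u v] by blast
  have "lkp u i \<noteq> lkp v i" using Min_in[OF _ ne] by (auto simp: i_def)
  moreover have eq: "lkp u j = lkp v j" if "j < i" for j
    using that Min_le[of "{i. lkp u i \<noteq> lkp v i}" j] unfolding i_def by fastforce
  ultimately consider "lkp u i > lkp v i" | "lkp v i > lkp u i" by linarith
  thus ?thesis
  proof cases
    case 1
    hence "term_less p u v" using True eq unfolding term_less_def by blast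
    thus ?thesis ..
  next
    case 2
    hence "term_less p v u" using True eq[symmetric] unfolding term_less_def by metis
    thus ?thesis by blast
  qed
next
  case False
  thus ?thesis unfolding term_less_def by (meson linorder_neqE_nat)
qed

lemma term_less_add_left: "term_less p (w + u) (w + v) \<longleftrightarrow> term_less p u v"
  by (simp add: term_less_def pdeg_add lookup_add)

lemma term_le_add_left: "term_le p (w + u) (w + v) \<longleftrightarrow> term_le p u v"
  by (simp add: term_le_def term_less_add_left)

lemma term_le_trans: "term_le p u v \<Longrightarrow> term_le p v w \<Longrightarrow> term_le p u w"
  by (auto simp: term_le_def intro: term_less_trans)

lemma term_le_antisym: "term_le p u v \<Longrightarrow> term_le p v u \<Longrightarrow> u = v"
  using term_less_trans term_less_irrefl by (fastforce simp: term_le_def)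

text \<open>Positive weights leave only finitely many monomials below a given one, so the number of
  predecessors is a strictly increasing rank in the naturals.\<close>

lemma wfp_term_less:
  fixes p :: "'n::{finite,linorder} \<Rightarrow> nat"
  assumes "\<And>i. p i > 0"
  shows "wfp (term_less p)"
proof -
  have fin: "finite {v. term_less p v u}" for u
    by (rule finite_subset[OF _ finite_pdeg_le[of p "pdeg p u", OF assms]]) (auto simp: term_less_def)
  show ?thesis
  proof (rule wfp_if_convertible_to_nat)
    fix u v assume "term_less p u v"
    thus "card {w. term_less p w u} < card {w. term_less p w v}"
      using term_less_trans[of p] term_less_irrefl[of p]
      by (intro psubset_card_mono[OF fin]) blast
  qed
qed

lemma is_lead_exists:
  assumes "f \<noteq> 0"
  shows "\<exists>u. is_lead p f u"
proof -
  have "\<exists>u\<in>A. \<forall>v\<in>A. term_le p v u" if "finite A" "A \<noteq> {}" for A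
    using that
  proof (induction rule: finite_ne_induct)
    case (singleton x)
    thus ?case by (auto simp: term_le_def)
  next
    case (insert x A)
    then obtain u where u: "u \<in> A" "\<forall>v\<in>A. term_le p v u" by blast
    have "term_le p x u \<or> term_le p u x" "term_le p x x"
      using term_less_linear[of p x u] by (auto simp: term_le_def)
    thus ?case using u term_le_trans[of p] by blast
  qed
  from this[of "Poly_Mapping.keys f"] assms show ?thesis by (auto simp: is_lead_def)
qed

text \<open>These turn out to be the standard monomials of the lattice ideal.\<close>

definition degree_minimal :: "('n::{finite,linorder} \<Rightarrow> nat) \<Rightarrow> ('n \<Rightarrow>\<^sub>0 nat) \<Rightarrow> bool" where
  "degree_minimal p u \<longleftrightarrow> (\<forall>v. pdeg p v = pdeg p u \<longrightarrow> term_le p u v)"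

lemma degree_minimal_unique:
  "degree_minimal p u \<Longrightarrow> degree_minimal p v \<Longrightarrow> pdeg p u = pdeg p v \<Longrightarrow> u = v"
  by (auto simp: degree_minimal_def intro: term_le_antisym)

lemma degree_minimal_exists:
  fixes p :: "'n::{finite,linorder} \<Rightarrow> nat"
  assumes "\<And>i. p i > 0"
  obtains m where "pdeg p m = pdeg p u" and "degree_minimal p m"
proof -
  obtain m where m: "m \<in> {v. pdeg p v = pdeg p u}"
    "\<And>v. term_less p v m \<Longrightarrow> v \<notin> {v. pdeg p v = pdeg p u}"
    using wfp_term_less[of p] assms
    unfolding wfp_eq_minimal by (metis (mono_tags, lifting) mem_Collect_eq)
  have "degree_minimal p m"
    unfolding degree_minimal_def
    using m term_less_linear[of p m] by (auto simp: term_le_def)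
  with m that show thesis by auto
qed

text \<open>Such a \<open>u\<close> has the largest possible first coordinate in its degree.\<close>

lemma degree_minimal_axis:
  fixes p :: "'n::{finite,linorder} \<Rightarrow> nat"
  assumes "\<And>i. p i > 0" and "\<And>i. i \<noteq> Min UNIV \<Longrightarrow> lkp u i = 0"
  shows "degree_minimal p u"
  unfolding degree_minimal_def
proof (intro allI impI)
  fix v assume deg: "pdeg p v = pdeg p u"
  have "\<not> term_less p v u"
  proof
    assume "term_less p v u"
    then obtain i where i: "lkp v i > lkp u i" "\<forall>j<i. lkp v j = lkp u j"
      using deg by (auto simp: term_less_def)
    have min: "Min UNIV \<le> j" for j :: 'n by simp
    \<comment> \<open>Before \<open>i\<close> the entries agree, and beyond \<open>i\<close> the
      index is not the first one, so \<open>u\<close> is zero there. Hence \<open>v\<close>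
      dominates \<open>u\<close>, against the equality of degrees.\<close>
    have "lkp u j \<le> lkp v j" for j
      using i assms(2)[of j] min[of i] by (cases "j = Min UNIV"; cases "j < i") (auto simp: order_le_less)
    hence "pdeg p u < pdeg p v" by (rule pdeg_strict_mono) (use i assms in auto)
    with deg show False by simp
  qed
  thus "term_le p u v" using term_less_linear[of p u v] by (auto simp: term_le_def)
qed

subsection \<open>Monomials and binomials\<close>

lemma poly_mapping_sum_single:
  "(\<Sum>u\<in>Poly_Mapping.keys f. Poly_Mapping.single u (lkp f u)) = f"
  by (rule poly_mapping_eqI)
     (auto simp: lookup_sum lookup_single when_def in_keys_iff)

text \<open>Cancellation makes the shift by \<open>w\<close> injective, so only the term of
  \<open>g\<close> at \<open>v\<close> lands on \<open>w + v\<close>.\<close>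

lemma lookup_single_mult:
  fixes w v :: "'a::cancel_comm_monoid_add"
  shows "lkp (Poly_Mapping.single w c * g) (w + v) = c * (lkp g v :: 'k::comm_ring_1)"
proof -
  have "Poly_Mapping.single w c * g =
      (\<Sum>u\<in>Poly_Mapping.keys g. Poly_Mapping.single (w + u) (c * lkp g u))"
    using arg_cong[OF poly_mapping_sum_single[of g], of "(*) (Poly_Mapping.single w c)"]
    by (simp add: sum_distrib_left mult_single)
  thus ?thesis by (auto simp: lookup_sum lookup_single when_def in_keys_iff)
qed

lemma xpow_add: "xpow (u + v) = xpow u * xpow v"
  by (simp add: xpow_def mult_single)

lemma xpow_dvd_iff: "(xpow v :: ('n, 'k::field) mpoly) dvd xpow u \<longleftrightarrow> (\<exists>w. u = v + w)"
proof
  assume "(xpow v :: ('n, 'k) mpoly) dvd xpow u"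
  then obtain h where "(xpow u :: ('n, 'k) mpoly) = xpow v * h" by (elim dvdE)
  moreover have "u \<in> Poly_Mapping.keys (xpow u :: ('n, 'k) mpoly)" by (simp add: xpow_def)
  ultimately have "u \<in> Poly_Mapping.keys (xpow v * h)" by simp
  thus "\<exists>w. u = v + w" using keys_mult[of "xpow v" h] by (auto simp: xpow_def)
qed (auto simp: xpow_add)

lemma keys_binomial: "u \<noteq> v \<Longrightarrow> Poly_Mapping.keys (xpow u - xpow v :: ('n, 'k::field) mpoly) = {u, v}"
  by (auto simp: xpow_def in_keys_iff lookup_minus lookup_single when_def split: if_splits)

lemma xpow_diff_eq_iff:
  "(xpow u - xpow v :: ('n, 'k::field) mpoly) = 0 \<longleftrightarrow> u = v"
  using keys_binomial[of u v, where 'k = 'k] by (cases "u = v") auto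

text \<open>The support gives the unordered pair of exponents and the order sorts it; in
  characteristic 2 the signs could not. The second alternative is the zero binomial.\<close>

lemma binomial_eqD:
  assumes eq: "xpow a - xpow b = (xpow c - xpow d :: ('n::{finite,linorder}, 'k::field) mpoly)"
    and le: "term_le p b a" "term_le p d c"
  shows "(a = c \<and> b = d) \<or> (a = b \<and> c = d)"
proof (cases "a = b")
  case True
  thus ?thesis using eq xpow_diff_eq_iff[of c d, where 'k = 'k] by simp
next
  case False
  have "c \<noteq> d"
    using eq False xpow_diff_eq_iff[of a b, where 'k = 'k] by auto
  hence "{a, b} = {c, d}" using eq False by (metis keys_binomial)
  thus ?thesis using le False term_le_antisym by (auto simp: doubleton_eq_iff)
qed

text \<open>Integer entries avoid truncated subtraction. Over a finite index type every function has
  finite support, so \<open>Abs_poly_mapping\<close> is harmless.\<close>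

definition exp_diff :: "('n::finite \<Rightarrow>\<^sub>0 nat) \<Rightarrow> ('n \<Rightarrow>\<^sub>0 nat) \<Rightarrow> ('n \<Rightarrow>\<^sub>0 int)" where
  "exp_diff u v = Abs_poly_mapping (\<lambda>i. int (lkp u i) - int (lkp v i))"

lemma lookup_exp_diff: "lkp (exp_diff u v) i = int (lkp u i) - int (lkp v i)"
  by (simp add: exp_diff_def)

lemma lookup_neg_part: "int (lkp (neg_part v) i) = max (- lkp v i) 0"
  by (simp add: neg_part_def lookup_pos_part)

lemma exp_diff_parts: "exp_diff (w + pos_part c) (w + neg_part c) = c"
  by (rule poly_mapping_eqI) (simp add: lookup_exp_diff lookup_add lookup_pos_part lookup_neg_part)

lemma pdeg_exp_diff: "pdeg p (exp_diff u v) = int (pdeg p u) - int (pdeg p v)"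
  by (simp add: pdeg_def lookup_exp_diff sum_subtractf left_diff_distrib)

lemma pdeg_parts: "pdeg p c = int (pdeg p (pos_part c)) - int (pdeg p (neg_part c))"
  using exp_diff_parts[of 0 c] pdeg_exp_diff[of p "pos_part c" "neg_part c"] by simp

lemma exp_diff_decompose:
  obtains w where "u = w + pos_part (exp_diff u v)" and "v = w + neg_part (exp_diff u v)"
proof
  \<comment> \<open>The coordinatewise minimum is the exponent of the gcd of the two
    monomials.\<close>
  let ?w = "Abs_poly_mapping (\<lambda>i. min (lkp u i) (lkp v i))"
  have w: "lkp ?w i = min (lkp u i) (lkp v i)" for i by simp
  show "u = ?w + pos_part (exp_diff u v)"
    by (rule poly_mapping_eqI, rule of_nat_eq_iff[where 'a = int, THEN iffD1])
       (simp add: lookup_add lookup_pos_part lookup_exp_diff w)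
  show "v = ?w + neg_part (exp_diff u v)"
    by (rule poly_mapping_eqI, rule of_nat_eq_iff[where 'a = int, THEN iffD1])
       (simp add: lookup_add lookup_neg_part lookup_exp_diff w)
qed

lemma xpow_mult_binomial: "xpow w * binomial_of c = xpow (w + pos_part c) - xpow (w + neg_part c)"
  by (simp add: binomial_of_def xpow_add right_diff_distrib)

subsection \<open>The lattice ideal\<close>

text \<open>Ideals are the submodules of the ring over itself; this gives span induction for
  \<open>ideal_gen\<close>.\<close>

interpretation ideal: module "(*) :: 'a::comm_ring_1 \<Rightarrow> 'a \<Rightarrow> 'a"
  by unfold_locales (simp_all add: algebra_simps)

text \<open>Taking out the gcd of the two monomials leaves the binomial of
  \<open>exp_diff u v\<close>, a generator because its degree is 0.\<close>

lemma xpow_diff_in_lattice_ideal: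
  assumes "pdeg p u = pdeg p v"
  shows "(xpow u - xpow v :: ('n::finite, 'k::field) mpoly) \<in> lattice_ideal p"
proof -
  obtain w where w: "u = w + pos_part (exp_diff u v)" "v = w + neg_part (exp_diff u v)"
    by (rule exp_diff_decompose)
  have "(xpow u - xpow v :: ('n, 'k) mpoly) = xpow w * binomial_of (exp_diff u v)"
    using w by (simp add: xpow_mult_binomial)
  moreover have "pdeg p (exp_diff u v) = 0" using assms by (simp add: pdeg_exp_diff)
  ultimately show ?thesis
    unfolding lattice_ideal_def ideal_gen_def by (metis (mono_tags, lifting) ideal.span_base ideal.span_scale mem_Collect_eq)
qed

text \<open>The substitution of \<open>z ^ p i\<close> for the \<open>i\<close>-th variable, a ring homomorphism into \<open>k[z]\<close>.\<close>

definition deg_hom :: "('n::finite \<Rightarrow> nat) \<Rightarrow> ('n, 'k::field) mpoly \<Rightarrow> (nat \<Rightarrow>\<^sub>0 'k)" where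
  "deg_hom p f = (\<Sum>u\<in>Poly_Mapping.keys f. Poly_Mapping.single (pdeg p u) (lkp f u))"

lemma deg_hom_0 [simp]: "deg_hom p 0 = 0"
  by (simp add: deg_hom_def)

lemma deg_hom_add: "deg_hom p (f + g) = deg_hom p f + deg_hom p g"
  unfolding deg_hom_def by (rule setsum_keys_plus_distrib) (auto simp: single_add)

lemma deg_hom_diff: "deg_hom p (f - g) = deg_hom p f - deg_hom p g"
  using deg_hom_add[of p "f - g" g] by simp

lemma deg_hom_sum: "deg_hom p (\<Sum>x\<in>A. h x) = (\<Sum>x\<in>A. deg_hom p (h x))"
  by (induction A rule: infinite_finite_induct) (auto simp: deg_hom_add)

lemma deg_hom_single: "deg_hom p (Poly_Mapping.single u c) = Poly_Mapping.single (pdeg p u) c"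
  by (cases "c = 0") (auto simp: deg_hom_def)

lemma deg_hom_mult: "deg_hom p (f * g) = deg_hom p f * deg_hom p g"
proof -
  have "f * g = (\<Sum>u\<in>Poly_Mapping.keys f. \<Sum>v\<in>Poly_Mapping.keys g.
      Poly_Mapping.single (u + v) (lkp f u * lkp g v))"
    using arg_cong2[OF poly_mapping_sum_single[of f] poly_mapping_sum_single[of g], of "(*)"]
    by (simp add: sum_product mult_single)
  thus ?thesis
    by (simp only: deg_hom_sum deg_hom_single)
       (simp add: deg_hom_def sum_product mult_single pdeg_add)
qed

text \<open>The two monomials of a generator have equal degree and go to the same power of
  \<open>z\<close>; additivity and multiplicativity extend the vanishing to the ideal.\<close>

lemma deg_hom_lattice_ideal:
  assumes "f \<in> lattice_ideal p"
  shows "deg_hom p f = 0"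
  using assms unfolding lattice_ideal_def ideal_gen_def
proof (induction rule: ideal.span_induct_alt)
  case (step c x y)
  then obtain v where "x = binomial_of v" "pdeg p v = 0" by blast
  hence "deg_hom p x = 0"
    using pdeg_parts[of p v] by (simp add: binomial_of_def deg_hom_diff xpow_def deg_hom_single)
  thus ?case using step by (simp add: deg_hom_add deg_hom_mult)
qed simp

text \<open>Distinct degree-minimal monomials have distinct degrees, so no two terms of
  \<open>f - g\<close> collide in \<open>k[z]\<close> and each coefficient can be read off the
  image.\<close>

lemma eq_if_deg_hom_eq:
  assumes "\<And>u. u \<in> Poly_Mapping.keys f \<Longrightarrow> degree_minimal p u"
    and "\<And>u. u \<in> Poly_Mapping.keys g \<Longrightarrow> degree_minimal p u"
    and "deg_hom p f = deg_hom p g"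
  shows "f = g"
proof -
  let ?h = "f - g"
  have min: "degree_minimal p u" if "u \<in> Poly_Mapping.keys ?h" for u
    using keys_diff[of f g] that assms(1,2) by blast
  have "lkp ?h u = 0" if u: "u \<in> Poly_Mapping.keys ?h" for u
  proof -
    have "lkp (deg_hom p ?h) (pdeg p u) =
        (\<Sum>v\<in>Poly_Mapping.keys ?h. if v = u then lkp ?h v else 0)"
      unfolding deg_hom_def lookup_sum
    proof (rule sum.cong)
      fix v assume "v \<in> Poly_Mapping.keys ?h"
      hence "pdeg p v = pdeg p u \<longleftrightarrow> v = u" using degree_minimal_unique[OF min min[OF u]] by blast
      thus "lkp (Poly_Mapping.single (pdeg p v) (lkp ?h v)) (pdeg p u) = (if v = u then lkp ?h v else 0)"
        by (simp add: lookup_single when_def)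
    qed simp
    also have "\<dots> = lkp ?h u" using u by simp
    finally show ?thesis using assms(3) by (simp add: deg_hom_diff)
  qed
  hence "lkp ?h u = 0" for u by (cases "u \<in> Poly_Mapping.keys ?h") (simp_all add: in_keys_iff)
  thus "f = g" by (intro poly_mapping_eqI) (simp add: lookup_minus)
qed

section \<open>Monomial ideals and standard monomials\<close>

lemma monomial_ideal_divisor:
  assumes "(xpow u :: ('n, 'k::field) mpoly) \<in> ideal_gen {xpow v | v. P v}"
  obtains v where "P v" and "(xpow v :: ('n, 'k) mpoly) dvd xpow u"
proof -
  \<comment> \<open>Strengthened for the induction: the claim covers every monomial of every element
    of the ideal.\<close>
  have "\<exists>v w. P v \<and> k = v + w" if "k \<in> Poly_Mapping.keys f"
    "f \<in> ideal_gen {xpow v | v. P v}" for f :: "('n, 'k) mpoly" and k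
    using that(2,1) unfolding ideal_gen_def
  proof (induction arbitrary: k rule: ideal.span_induct_alt)
    case (step c x y)
    obtain v where v: "x = xpow v" "P v" using step by blast
    have "k \<in> Poly_Mapping.keys (c * x) \<or> k \<in> Poly_Mapping.keys y"
      using step.prems keys_add[of "c * x" y] by blast
    thus ?case
    proof
      assume "k \<in> Poly_Mapping.keys (c * x)"
      then obtain w w' where w: "k = w + w'" "w' \<in> Poly_Mapping.keys x" using keys_mult[of c x] by blast
      moreover have "w' = v" using w(2) v by (simp add: xpow_def)
      ultimately show ?case using v(2) by (metis add.commute)
    qed (use step.IH in blast)
  qed simp
  moreover have "u \<in> Poly_Mapping.keys (xpow u :: ('n, 'k) mpoly)" by (simp add: xpow_def)
  ultimately obtain v w where "P v" "u = v + w" using assms by blast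
  thus thesis using that by (simp add: xpow_dvd_iff)
qed

definition irreducible_exp ::
    "('n::{finite,linorder} \<Rightarrow> nat) \<Rightarrow> ('n, 'k::field) mpoly set \<Rightarrow> ('n \<Rightarrow>\<^sub>0 nat) \<Rightarrow> bool" where
  "irreducible_exp p G u \<longleftrightarrow>
     (\<forall>g\<in>G. \<forall>v. is_lead p g v \<longrightarrow> \<not> (xpow v :: ('n, 'k) mpoly) dvd xpow u)"

text \<open>A smaller monomial \<open>v\<close> of the same degree would make
  \<open>xpow u - xpow v\<close> an element of the lattice ideal led by \<open>u\<close>. The
  Groebner property then yields a leading monomial of \<open>G\<close> dividing
  \<open>xpow u\<close>.\<close>

lemma irreducible_exp_imp_degree_minimal:
  fixes G :: "('n::{finite,linorder}, 'k::field) mpoly set"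
  assumes G: "groebner_basis p G (lattice_ideal p)" and irr: "irreducible_exp p G u"
  shows "degree_minimal p u"
proof (rule ccontr)
  assume "\<not> degree_minimal p u"
  then obtain v where v: "pdeg p v = pdeg p u" "term_less p v u"
    using term_less_linear[of p u] by (auto simp: degree_minimal_def term_le_def)
  hence "u \<noteq> v" using term_less_irrefl by auto
  hence "is_lead p (xpow u - xpow v :: ('n, 'k) mpoly) u"
    using v by (auto simp: is_lead_def keys_binomial term_le_def)
  hence "(xpow u :: ('n, 'k) mpoly) \<in> initial_ideal p (lattice_ideal p)"
    unfolding initial_ideal_def ideal_gen_def
    using xpow_diff_in_lattice_ideal[of p u v] v by (intro ideal.span_base) auto
  hence "(xpow u :: ('n, 'k) mpoly) \<in> initial_ideal p G"
    using G by (simp add: groebner_basis_def)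
  thus False unfolding initial_ideal_def
    by (rule monomial_ideal_divisor) (use irr in \<open>auto simp: irreducible_exp_def\<close>)
qed

subsection \<open>Division\<close>

text \<open>The bound \<open>b\<close> is imposed on all monomials of \<open>q g * g\<close>, not only on the leading one as in
  \<^const>\<open>is_remainder\<close>: this makes the predicate additive in \<open>f\<close>.\<close>

definition divisible_below ::
    "('n::{finite,linorder} \<Rightarrow> nat) \<Rightarrow> ('n, 'k::field) mpoly set \<Rightarrow> ('n \<Rightarrow>\<^sub>0 nat) \<Rightarrow> ('n, 'k) mpoly \<Rightarrow> bool" where
  "divisible_below p G b f \<longleftrightarrow>
     (\<exists>q r. f = (\<Sum>g\<in>G. q g * g) + r \<and>
        (\<forall>g\<in>G. \<forall>u\<in>Poly_Mapping.keys (q g * g). term_le p u b) \<and>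
        (\<forall>u\<in>Poly_Mapping.keys r. irreducible_exp p G u))"

lemma divisible_below_mono:
  "divisible_below p G b f \<Longrightarrow> term_le p b c \<Longrightarrow> divisible_below p G c f"
  unfolding divisible_below_def by (blast intro: term_le_trans)

lemma divisible_below_0: "divisible_below p G b 0"
  unfolding divisible_below_def by (intro exI[of _ "\<lambda>_. 0"] exI[of _ 0]) simp

lemma divisible_below_add:
  assumes "divisible_below p G b f" and "divisible_below p G b f'"
  shows "divisible_below p G b (f + f')"
proof -
  obtain q r where 1: "f = (\<Sum>g\<in>G. q g * g) + r"
    "\<forall>g\<in>G. \<forall>u\<in>Poly_Mapping.keys (q g * g). term_le p u b"
    "\<forall>u\<in>Poly_Mapping.keys r. irreducible_exp p G u"
    using assms(1) unfolding divisible_below_def by blast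
  obtain q' r' where 2: "f' = (\<Sum>g\<in>G. q' g * g) + r'"
    "\<forall>g\<in>G. \<forall>u\<in>Poly_Mapping.keys (q' g * g). term_le p u b"
    "\<forall>u\<in>Poly_Mapping.keys r'. irreducible_exp p G u"
    using assms(2) unfolding divisible_below_def by blast
  have "f + f' = (\<Sum>g\<in>G. (q g + q' g) * g) + (r + r')"
    by (simp add: 1(1) 2(1) distrib_right sum.distrib)
  moreover have "\<forall>g\<in>G. \<forall>u\<in>Poly_Mapping.keys ((q g + q' g) * g). term_le p u b"
    using 1(2) 2(2) keys_add[of "q g * g" "q' g * g" for g] unfolding distrib_right by blast
  moreover have "\<forall>u\<in>Poly_Mapping.keys (r + r'). irreducible_exp p G u"
    using 1(3) 2(3) keys_add[of r r'] by blast
  ultimately show ?thesis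
    unfolding divisible_below_def by (intro exI[of _ "\<lambda>g. q g + q' g"] exI[of _ "r + r'"] conjI)
qed

lemma divisible_below_keys:
  assumes "\<And>u. u \<in> Poly_Mapping.keys f \<Longrightarrow> divisible_below p G b (Poly_Mapping.single u (lkp f u))"
  shows "divisible_below p G b f"
proof -
  have "divisible_below p G b (\<Sum>u\<in>A. Poly_Mapping.single u (lkp f u))"
    if "finite A" "A \<subseteq> Poly_Mapping.keys f" for A
    using that by induction (auto intro!: divisible_below_0 divisible_below_add assms)
  from this[of "Poly_Mapping.keys f"] show ?thesis by (simp add: poly_mapping_sum_single)
qed

text \<open>Well-founded induction on \<open>u\<close>: an irreducible monomial is its own
  remainder, and otherwise one reduction step leaves only smaller monomials.\<close>

lemma divisible_below_single:
  fixes p :: "'n::{finite,linorder} \<Rightarrow> nat" and G :: "('n, 'k::field) mpoly set"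
  assumes pos: "\<And>i. p i > 0" and "finite G"
  shows "divisible_below p G u (Poly_Mapping.single u c)"
proof (induction u arbitrary: c rule: wfp_induct_rule[OF wfp_term_less[of p, OF pos]])
  case (1 u)
  show ?case
  proof (cases "irreducible_exp p G u")
    case True
    thus ?thesis unfolding divisible_below_def
      by (intro exI[of _ "\<lambda>_. 0"] exI[of _ "Poly_Mapping.single u c"])
         (auto simp: lookup_single when_def in_keys_iff split: if_splits)
  next
    case False
    then obtain g v w where g: "g \<in> G" "is_lead p g v" "u = w + v"
      unfolding irreducible_exp_def xpow_dvd_iff by (metis add.commute)
    \<comment> \<open>Chosen so that the leading term of \<open>m * g\<close> has exponent
      \<open>u\<close> and coefficient \<open>c\<close>, hence cancels in \<open>h\<close>.\<close>
    define m where "m = Poly_Mapping.single w (c / lkp g v)"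
    have keys: "term_le p k u" if kmem: "k \<in> Poly_Mapping.keys (m * g)" for k
    proof -
      obtain i j where k: "k = i + j" "i \<in> Poly_Mapping.keys m" "j \<in> Poly_Mapping.keys g"
        using keys_mult[of m g] kmem by blast
      moreover have "i = w" using k(2) by (simp add: m_def split: if_splits)
      ultimately have "k = w + j" "j \<in> Poly_Mapping.keys g" by simp_all
      thus ?thesis using g by (auto simp: is_lead_def term_le_add_left)
    qed
    have "divisible_below p G u (m * g)"
      unfolding divisible_below_def
      by (intro exI[of _ "\<lambda>x. if x = g then m else 0"] exI[of _ 0])
         (use g keys \<open>finite G\<close> in \<open>auto simp: if_distrib[of "\<lambda>x. x * _"] cong: if_cong\<close>)
    moreover define h where "h = Poly_Mapping.single u c - m * g"
    have "divisible_below p G u h"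
    proof (rule divisible_below_keys)
      fix k assume k: "k \<in> Poly_Mapping.keys h"
      have "lkp g v \<noteq> 0" using g by (auto simp: is_lead_def in_keys_iff)
      hence "lkp h u = 0"
        unfolding h_def m_def lookup_minus g(3) lookup_single_mult by simp
      hence "k \<noteq> u" using k by (auto simp: in_keys_iff)
      moreover have "k \<in> {u} \<union> Poly_Mapping.keys (m * g)"
        using k keys_diff[of "Poly_Mapping.single u c" "m * g"] unfolding h_def
        by (auto split: if_splits)
      ultimately have "term_less p k u" using keys by (auto simp: term_le_def)
      thus "divisible_below p G u (Poly_Mapping.single k (lkp h k))"
        using 1 divisible_below_mono unfolding term_le_def by blast
    qed
    ultimately have "divisible_below p G u (m * g + h)" by (rule divisible_below_add)
    thus ?thesis by (simp add: h_def)
  qed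
qed

text \<open>The leading monomial of \<open>f\<close> bounds all others, so the divisions of the
  single terms add up under this one bound.\<close>

lemma is_remainder_exists:
  fixes p :: "'n::{finite,linorder} \<Rightarrow> nat" and G :: "('n, 'k::field) mpoly set"
  assumes pos: "\<And>i. p i > 0" and fin: "finite G"
  shows "\<exists>r. is_remainder p G f r"
proof (cases "f = 0")
  case True
  \<comment> \<open>The zero polynomial has no leading monomial to serve as a bound, so all
    quotients are taken to be 0.\<close>
  thus ?thesis unfolding is_remainder_def
    by (intro exI[of _ 0] conjI exI[of _ "\<lambda>_. 0"]) (auto simp: is_lead_def)
next
  case False
  then obtain b where b: "is_lead p f b" using is_lead_exists by blast
  have "divisible_below p G b f"
  proof (rule divisible_below_keys)
    fix u assume "u \<in> Poly_Mapping.keys f"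
    hence "term_le p u b" using b by (simp add: is_lead_def)
    thus "divisible_below p G b (Poly_Mapping.single u (lkp f u))"
      by (rule divisible_below_mono[OF divisible_below_single[OF pos fin]])
  qed
  then obtain q r where qr: "f = (\<Sum>g\<in>G. q g * g) + r"
    "\<forall>g\<in>G. \<forall>u\<in>Poly_Mapping.keys (q g * g). term_le p u b"
    "\<forall>u\<in>Poly_Mapping.keys r. irreducible_exp p G u"
    unfolding divisible_below_def by blast
  have "\<exists>v. is_lead p f v \<and> term_le p u v" if "g \<in> G" "is_lead p (q g * g) u" for g u
    using that qr(2) b unfolding is_lead_def[of p "q g * g"] by blast
  hence "is_remainder p G f r"
    using qr unfolding is_remainder_def irreducible_exp_def by blast
  thus ?thesis ..
qed

text \<open>A remainder consists of degree-minimal monomials and has the same image as the dividend under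
  \<^const>\<open>deg_hom\<close>, which is injective on such polynomials.\<close>

lemma remainder_unique:
  assumes G: "groebner_basis p G (lattice_ideal p)" and r: "is_remainder p G f r"
    and min: "\<And>u. u \<in> Poly_Mapping.keys s \<Longrightarrow> degree_minimal p u" and "deg_hom p s = deg_hom p f"
  shows "r = s"
proof (rule eq_if_deg_hom_eq[OF _ min])
  obtain q where q: "f = (\<Sum>g\<in>G. q g * g) + r" using r by (auto simp: is_remainder_def)
  \<comment> \<open>Elements of \<open>G\<close> lie in the lattice ideal, so \<open>deg_hom\<close>
    kills the quotient part.\<close>
  have "deg_hom p g = 0" if "g \<in> G" for g
    using G that by (auto simp: groebner_basis_def intro: deg_hom_lattice_ideal)
  hence "deg_hom p f = deg_hom p r"
    by (simp add: q deg_hom_add deg_hom_sum deg_hom_mult)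
  thus "deg_hom p r = deg_hom p s" using assms by simp
  show "degree_minimal p u" if "u \<in> Poly_Mapping.keys r" for u
    using r that by (intro irreducible_exp_imp_degree_minimal[OF G])
      (auto simp: is_remainder_def irreducible_exp_def)
qed

subsection \<open>Representability\<close>

text \<open>Coefficients for the smaller set are scaled by the factor \<open>b\<close> of the
  two-term identity for \<open>p j\<close> and the previous gcd. The empty sum matches
  \<open>Gcd {} = 0\<close>.\<close>

lemma bezout_finite:
  fixes p :: "'a \<Rightarrow> nat"
  assumes "finite A"
  shows "\<exists>x. (\<Sum>i\<in>A. x i * int (p i)) = int (Gcd (p ` A))"
  using assms
proof induction
  case (insert j A)
  then obtain x where x: "(\<Sum>i\<in>A. x i * int (p i)) = int (Gcd (p ` A))" by blast
  obtain a b where ab: "a * int (p j) + b * int (Gcd (p ` A)) = gcd (int (p j)) (int (Gcd (p ` A)))"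
    using bezout_int by blast
  have "(\<Sum>i\<in>A. (if i = j then a else b * x i) * int (p i)) = (\<Sum>i\<in>A. b * (x i * int (p i)))"
    using insert by (intro sum.cong) auto
  also have "\<dots> = b * int (Gcd (p ` A))" by (simp only: x flip: sum_distrib_left)
  finally show ?case using insert ab
    by (intro exI[of _ "\<lambda>i. if i = j then a else b * x i"]) simp
qed simp

text \<open>A Bezout vector scaled by \<open>t\<close> has the right degree; a vector of degree 0 is
  added to correct its signs. With one index the only vector of degree \<open>t\<close> is
  \<open>t\<close> itself, which has the wrong sign for \<open>t > 0\<close>.\<close>

lemma step1_exists:
  fixes p :: "'n::{finite,linorder} \<Rightarrow> nat"
  assumes pos: "\<And>i. p i > 0" and gcd: "Gcd (range p) = 1" and card: "card (UNIV :: 'n set) \<ge> 2"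
  shows "\<exists>a. step1 p t a"
proof -
  obtain x where x: "(\<Sum>i\<in>UNIV. x i * int (p i)) = 1"
    using bezout_finite[of "UNIV :: 'n set" p] gcd by auto
  let ?m = "Min UNIV :: 'n" and ?R = "UNIV - {Min UNIV :: 'n}"
  define y where "y i = int t * x i" for i
  define K where "K = (\<Sum>i\<in>UNIV. \<bar>y i\<bar>)"
  have K: "\<bar>y i\<bar> \<le> K" for i unfolding K_def by (rule member_le_sum) auto
  hence K0: "0 \<le> K" by (meson abs_ge_zero order_trans)
  \<comment> \<open>The two corrections cancel in the degree: each other index \<open>j\<close>
    contributes \<open>K * p ?m * p j\<close>, and the first index removes their sum. The bound
    \<open>K\<close> on all \<open>\<bar>y i\<bar>\<close> makes them large enough.\<close>
  define a where "a i = (if i = ?m then y i - K * (\<Sum>j\<in>?R. int (p j)) else y i + K * int (p ?m))" for i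
  have "(\<Sum>i\<in>UNIV. a i * int (p i)) = a ?m * int (p ?m) + (\<Sum>i\<in>?R. a i * int (p i))"
    by (rule sum.remove) auto
  also have "(\<Sum>i\<in>?R. a i * int (p i)) = (\<Sum>i\<in>?R. y i * int (p i) + K * int (p ?m) * int (p i))"
    by (rule sum.cong) (simp_all add: a_def distrib_right)
  also have "\<dots> = (\<Sum>i\<in>?R. y i * int (p i)) + K * int (p ?m) * (\<Sum>i\<in>?R. int (p i))"
    by (simp only: sum.distrib sum_distrib_left)
  also have "a ?m * int (p ?m) + \<dots> = y ?m * int (p ?m) + (\<Sum>i\<in>?R. y i * int (p i))"
    by (simp add: a_def left_diff_distrib)
  also have "\<dots> = (\<Sum>i\<in>UNIV. y i * int (p i))"
    by (rule sum.remove[symmetric]) auto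
  also have "\<dots> = int t * (\<Sum>i\<in>UNIV. x i * int (p i))"
    by (simp only: y_def mult.assoc sum_distrib_left)
  also have "\<dots> = int t" by (simp only: x mult_1_right)
  finally have deg: "(\<Sum>i\<in>UNIV. a i * int (p i)) = int t" .
  have "card ?R \<ge> 1" using card by (simp add: card_Diff_singleton)
  then obtain j where j: "j \<in> ?R" by (metis card.empty equals0I not_one_le_zero)
  have "int (p j) \<le> (\<Sum>j\<in>?R. int (p j))" using j by (intro member_le_sum) auto
  hence "1 \<le> (\<Sum>j\<in>?R. int (p j))" using pos[of j] by linarith
  hence "K \<le> K * (\<Sum>j\<in>?R. int (p j))" using K0 by (simp add: mult_le_cancel_left1)
  hence "a ?m \<le> 0" using K[of ?m] by (simp add: a_def)
  moreover have "a i \<ge> 0" if "i \<noteq> ?m" for i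
  proof -
    have "K \<le> K * int (p ?m)" using K0 pos[of ?m] by (simp add: mult_le_cancel_left1)
    thus ?thesis using K[of i] that by (simp add: a_def)
  qed
  ultimately have "step1 p t (Abs_poly_mapping a)"
    using deg by (simp add: step1_def pdeg_def)
  thus ?thesis ..
qed

lemma representable_if_nonneg:
  assumes "pdeg p c = t" and "\<And>i. lkp c i \<ge> 0"
  shows "representable p t"
proof -
  have "neg_part c = 0"
    by (rule poly_mapping_eqI, rule of_nat_eq_iff[where 'a = int, THEN iffD1])
       (use assms(2) in \<open>simp add: lookup_neg_part\<close>)
  hence "t = int (pdeg p (pos_part c))" using pdeg_parts[of p c] assms(1) by (simp add: pdeg_def)
  thus ?thesis by (auto simp: representable_def)
qed

text \<open>The tie is decided by the larger entry at the first differing index; if that is a later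
  index, the first coordinates agree.\<close>

lemma term_le_first_coordinate:
  fixes u v :: "'n::{finite,linorder} \<Rightarrow>\<^sub>0 nat"
  assumes "term_le p u v" and "pdeg p u = pdeg p v"
  shows "lkp v (Min UNIV) \<le> lkp u (Min UNIV)"
proof (cases "u = v")
  case False
  then obtain i where i: "lkp u i > lkp v i" "\<forall>j<i. lkp u j = lkp v j"
    using assms by (auto simp: term_le_def term_less_def)
  hence "lkp v j \<le> lkp u j" if "j \<le> i" for j using that by (cases "j = i") auto
  thus ?thesis by simp
qed simp

text \<open>A representation \<open>z\<close> of \<open>t\<close> puts \<open>v + z\<close> into the
  degree of \<open>m\<close>, so minimality bounds the first coordinate of \<open>v\<close> by that
  of \<open>m\<close>; the others are zero. Conversely \<open>exp_diff m v\<close> has degree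
  \<open>t\<close>.\<close>

lemma representable_iff_nonneg:
  fixes p :: "'n::{finite,linorder} \<Rightarrow> nat"
  assumes m: "degree_minimal p m" and deg: "int (pdeg p m) = int (pdeg p v) + int t"
    and axis: "\<And>i. i \<noteq> Min UNIV \<Longrightarrow> lkp v i = 0"
  shows "representable p (int t) \<longleftrightarrow> (\<forall>i. lkp (exp_diff m v) i \<ge> 0)"
proof
  assume "representable p (int t)"
  then obtain z :: "'n \<Rightarrow>\<^sub>0 nat" where z: "t = pdeg p z" by (auto simp: representable_def)
  have "pdeg p (v + z) = pdeg p m" using z deg by (simp add: pdeg_add)
  hence "lkp (v + z) (Min UNIV) \<le> lkp m (Min UNIV)"
    using m by (intro term_le_first_coordinate) (auto simp: degree_minimal_def)
  hence "lkp v i \<le> lkp m i" for i using axis[of i] by (cases "i = Min UNIV") (auto simp: lookup_add)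
  thus "\<forall>i. lkp (exp_diff m v) i \<ge> 0" by (simp add: lookup_exp_diff)
next
  assume "\<forall>i. lkp (exp_diff m v) i \<ge> 0"
  thus "representable p (int t)"
    using deg by (intro representable_if_nonneg[of p "exp_diff m v"]) (auto simp: pdeg_exp_diff)
qed

text \<open>That each step has an output is stated apart from correctness, which covers every
  remainder and every way of writing it.\<close>

theorem mainTheorem1:
  fixes p :: "'n::{finite,linorder} \<Rightarrow> nat"
    and G :: "('n, 'k::field) mpoly set"
    and t :: nat
  assumes "\<And>i. p i > 0"
    and "Gcd (range p) = 1"
    and "groebner_basis p G (lattice_ideal p)"
  shows "(card (UNIV :: 'n set) \<ge> 2 \<longrightarrow> (\<exists>a. step1 p t a)) \<and>
    (\<forall>a. step1 p t a \<longrightarrow>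
       (\<exists>r. is_remainder p G (binomial_of a) r) \<and>
       (\<forall>r. is_remainder p G (binomial_of a) r \<longrightarrow>
          (\<exists>w c. r = xpow w * binomial_of c \<and> term_le p (neg_part c) (pos_part c)) \<and>
          (\<forall>w c. r = xpow w * binomial_of c \<and> term_le p (neg_part c) (pos_part c) \<longrightarrow>
             (representable p (int t) \<longleftrightarrow> (\<forall>i. Poly_Mapping.lookup c i \<ge> 0)))))"
proof (intro conjI impI allI)
  assume "card (UNIV :: 'n set) \<ge> 2"
  thus "\<exists>a. step1 p t a" using step1_exists[of p] assms by blast
next
  fix a assume "step1 p t a"
  show "\<exists>r. is_remainder p G (binomial_of a) r"
    using assms by (intro is_remainder_exists) (auto simp: groebner_basis_def)
next
  fix a r assume a: "step1 p t a" and r: "is_remainder p G (binomial_of a) r"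
  define v where "v = neg_part a"
  \<comment> \<open>The signs in \<open>step1\<close> leave the first index as the only possible
    negative entry of \<open>a\<close>.\<close>
  have axis: "lkp v i = 0" if "i \<noteq> Min UNIV" for i
  proof -
    have "int (lkp v i) = 0"
      using a that by (auto simp: v_def lookup_neg_part step1_def)
    thus ?thesis by simp
  qed
  hence v: "degree_minimal p v" using assms by (intro degree_minimal_axis) auto
  obtain m where m: "pdeg p m = pdeg p (pos_part a)" "degree_minimal p m"
    using degree_minimal_exists[of p] assms by blast
  have deg: "int (pdeg p m) = int (pdeg p v) + int t"
    using a m pdeg_parts[of p a] by (simp add: step1_def v_def)
  have r_eq: "r = xpow m - xpow v"
  proof (rule remainder_unique[OF assms(3) r])
    show "degree_minimal p u" if "u \<in> Poly_Mapping.keys (xpow m - xpow v :: ('n, 'k) mpoly)" for u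
      using that v m by (cases "m = v") (auto simp: keys_binomial)
    show "deg_hom p (xpow m - xpow v :: ('n, 'k) mpoly) = deg_hom p (binomial_of a)"
      by (simp add: binomial_of_def deg_hom_diff xpow_def deg_hom_single m v_def)
  qed
  \<comment> \<open>For \<open>t = 0\<close> both monomials are minimal in the same degree and
    coincide; otherwise the degrees decide.\<close>
  have le: "term_le p v m"
  proof (cases "t = 0")
    case True
    thus ?thesis using degree_minimal_unique[OF v m(2)] deg by (simp add: term_le_def)
  next
    case False
    thus ?thesis using deg by (simp add: term_le_def term_less_def)
  qed
  show "\<exists>w c. r = xpow w * binomial_of c \<and> term_le p (neg_part c) (pos_part c)"
  proof -
    obtain w where w: "m = w + pos_part (exp_diff m v)" "v = w + neg_part (exp_diff m v)"
      by (rule exp_diff_decompose)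
    hence "r = xpow w * binomial_of (exp_diff m v)" by (simp add: r_eq xpow_mult_binomial)
    moreover have "term_le p (neg_part (exp_diff m v)) (pos_part (exp_diff m v))"
      using le w by (metis term_le_add_left)
    ultimately show ?thesis by blast
  qed
  fix w c assume c: "r = xpow w * binomial_of c \<and> term_le p (neg_part c) (pos_part c)"
  let ?u = "w + pos_part c" and ?l = "w + neg_part c"
  have "(?u = m \<and> ?l = v) \<or> (?u = ?l \<and> m = v)"
    using c le r_eq
    by (intro binomial_eqD[where 'k = 'k]) (auto simp: xpow_mult_binomial term_le_add_left)
  \<comment> \<open>For a zero remainder \<open>w\<close> is arbitrary, but \<open>c\<close> and
    \<open>exp_diff m v\<close> are both the zero vector.\<close>
  moreover have "exp_diff u u = exp_diff u' u'" for u u' :: "'n \<Rightarrow>\<^sub>0 nat"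
    by (rule poly_mapping_eqI) (simp add: lookup_exp_diff)
  ultimately have "c = exp_diff m v"
    using exp_diff_parts[of w c] by metis
  thus "representable p (int t) \<longleftrightarrow> (\<forall>i. lkp c i \<ge> 0)"
    using representable_iff_nonneg[OF m(2) deg axis] by simp
qed

end
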